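(* Assume that $l:\mathbb{R}\to\mathbb{R}$ is a $\mathcal{C}^2$-function, that $h$ is a $\mathcal{C}^2$-function with respect to $\theta$, and that $\nabla_\theta h(\theta,x)$, $\nabla_\theta^2h(\theta,x)$ and the eigenvalues of the latter matrix are uniformly bounded on $\Theta\times\mathcal{X}$. Let $\mu_*\in\overline{\mathcal{P}}_2$ be a local minimum of $\mathcal{L}_S(\mu)$ (over $\overline{\mathcal{P}}_2$) with respect to the metric $d_{\mathcal{F}}$. Then $$\|\mathbb{E}_S[s_{\mu_*}(\theta,x,y)]\|_{L^2(\mu_* )}=0.$$
   Context: $\Theta=\mathbb{R}^d$, $\mathcal{X}\subset\mathbb{R}^n$ is Borel, $\mathcal{Y}=\{-1,1\}$; $h:\Theta\times\mathcal{X}\to[-1,1]$ is Borel measurable and continuous in $x$; $l:\mathbb{R}\to\mathbb{R}$ is a loss function. $S=\{(x_j,y_j)\}_{j=1}^N\subset\mathcal{X}\times\mathcal{Y}$ is a fixed finite dataset and $\mathbb{E}_S$ is the average over $S$ (in the variables $(x,y)$). $\mathcal{P}$ is the set of Borel probability measures on $\Theta$ and $\mathcal{P}_2\subset\mathcal{P}$ the subset of those with finite second moment. For $\mu\in\mathcal{P}$, $h_\mu(x)=\mathbb{E}_{\theta\sim\mu}[h(\theta,x)]$, $\mathcal{L}_S(\mu)=\frac1N\sum_{j=1}^Nl(-y_jh_\mu(x_j))$, and $s_\mu(\theta,x,y)=-l'(-yh_\mu(x))\,y\,\nabla_\theta h(\theta,x)$. $\|\xi\|_{L^2(\mu)}^2=\mathbb{E}_\mu[\|\xi(\theta)\|_2^2]$.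 For a fixed constant $C>0$, $\mathcal{F}=\mathcal{F}_C$ is the set of functions $f$ on $\Theta$ with $|f|\le C$ and $f$ $C$-Lipschitz for the Euclidean norm; $d_{\mathcal{F}}(\mu,\nu)=\sup_{f\in\mathcal{F}}|\int f\,d\mu-\int f\,d\nu|$ is a metric on $\mathcal{P}$. $\overline{\mathcal{P}}_2$ is the closure of $\mathcal{P}_2$ in $(\mathcal{P},d_{\mathcal{F}})$. *)

theory Defs
  imports "HOL-Probability.Probability"
begin

definition gradient :: "('a::real_inner \<Rightarrow> real) \<Rightarrow> 'a \<Rightarrow> 'a" where
  "gradient f \<theta> = (THE D. GDERIV f \<theta> :> D)"

definition hessian :: "(real ^ 'd \<Rightarrow> real) \<Rightarrow> real ^ 'd \<Rightarrow> real ^ 'd ^ 'd" where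
  "hessian f \<theta> = matrix (frechet_derivative (gradient f) (at \<theta>))"

text \<open>Both derivatives below exist everywhere, so the total operators \<open>gradient\<close>,
  \<open>hessian\<close> and \<open>deriv\<close> take their intended values; continuity of the
  lower-order derivatives follows from differentiability.\<close>

definition C2_function :: "(real ^ 'd \<Rightarrow> real) \<Rightarrow> bool" where
  "C2_function f \<longleftrightarrow>
     (\<forall>\<theta>. f differentiable (at \<theta>)) \<and>
     (\<forall>\<theta>. gradient f differentiable (at \<theta>)) \<and>
     continuous_on UNIV (hessian f)"

definition C2_real_function :: "(real \<Rightarrow> real) \<Rightarrow> bool" where
  "C2_real_function f \<longleftrightarrow>
     (\<forall>t. f field_differentiable (at t)) \<and> deriv f C1_differentiable_on UNIV"

text \<open>Real eigenvalues only: the matrices in question are Hessians of \<open>C\<^sup>2\<close>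
  functions, hence symmetric.\<close>

definition eigenvalues :: "real ^ 'd ^ 'd \<Rightarrow> real set" where
  "eigenvalues A = {k. \<exists>v. v \<noteq> 0 \<and> A *v v = k *\<^sub>R v}"

definition prob_measures :: "'a::euclidean_space measure set" where
  "prob_measures = {\<mu>. prob_space \<mu> \<and> sets \<mu> = sets borel}"

definition prob_measures2 :: "'a::euclidean_space measure set" where
  "prob_measures2 = {\<mu> \<in> prob_measures. integrable \<mu> (\<lambda>\<theta>. (norm \<theta>)\<^sup>2)}"

definition test_functions :: "real \<Rightarrow> ('a::euclidean_space \<Rightarrow> real) set" where
  "test_functions C = {f. (\<forall>\<theta>. \<bar>f \<theta>\<bar> \<le> C) \<and> C-lipschitz_on UNIV f}"

text \<open>On \<open>prob_measures\<close> the supremum is over a nonempty set bounded by \<open>2 * C\<close>;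
  elsewhere the value is meaningless. This is also why the closure below is spelled out:
  the library's \<open>Metric_space\<close> demands nonnegativity of the distance off the carrier, too.\<close>

definition dist_F :: "real \<Rightarrow> 'a::euclidean_space measure \<Rightarrow> 'a measure \<Rightarrow> real" where
  "dist_F C \<mu> \<nu> =
     (SUP f \<in> test_functions C. \<bar>(\<integral>\<theta>. f \<theta> \<partial>\<mu>) - (\<integral>\<theta>. f \<theta> \<partial>\<nu>)\<bar>)"

definition closure_prob_measures2 :: "real \<Rightarrow> 'a::euclidean_space measure set" where
  "closure_prob_measures2 C =
     {\<mu> \<in> prob_measures. \<forall>\<epsilon>>0. \<exists>\<nu> \<in> prob_measures2. dist_F C \<mu> \<nu> < \<epsilon>}"

definition local_minimum_on ::
  "('b \<Rightarrow> 'b \<Rightarrow> real) \<Rightarrow> 'b set \<Rightarrow> ('b \<Rightarrow> real) \<Rightarrow> 'b \<Rightarrow> bool" where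
  "local_minimum_on d M L \<mu> \<longleftrightarrow>
     \<mu> \<in> M \<and> (\<exists>\<epsilon>>0. \<forall>\<nu>\<in>M. d \<mu> \<nu> < \<epsilon> \<longrightarrow> L \<mu> \<le> L \<nu>)"

definition mean_h :: "('a \<Rightarrow> 'b \<Rightarrow> real) \<Rightarrow> 'a measure \<Rightarrow> 'b \<Rightarrow> real" where
  "mean_h h \<mu> x = (\<integral>\<theta>. h \<theta> x \<partial>\<mu>)"

text \<open>The dataset of size \<open>N\<close> is the family of pairs \<open>(xs j, ys j)\<close>, \<open>j \<in> {1..N}\<close>.\<close>

definition sample_mean ::
  "nat \<Rightarrow> (nat \<Rightarrow> 'b) \<Rightarrow> (nat \<Rightarrow> real) \<Rightarrow> ('b \<Rightarrow> real \<Rightarrow> 'c::real_vector) \<Rightarrow> 'c" where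
  "sample_mean N xs ys g = (1 / real N) *\<^sub>R (\<Sum>j\<in>{1..N}. g (xs j) (ys j))"

definition emp_loss ::
  "(real \<Rightarrow> real) \<Rightarrow> ('a \<Rightarrow> 'b \<Rightarrow> real) \<Rightarrow> nat \<Rightarrow> (nat \<Rightarrow> 'b) \<Rightarrow> (nat \<Rightarrow> real) \<Rightarrow>
     'a measure \<Rightarrow> real" where
  "emp_loss l h N xs ys \<mu> = (1 / real N) * (\<Sum>j\<in>{1..N}. l (- ys j * mean_h h \<mu> (xs j)))"

definition score ::
  "(real \<Rightarrow> real) \<Rightarrow> ('a::real_inner \<Rightarrow> 'b \<Rightarrow> real) \<Rightarrow> 'a measure \<Rightarrow>
     'a \<Rightarrow> 'b \<Rightarrow> real \<Rightarrow> 'a" where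
  "score l h \<mu> \<theta> x y =
     (- deriv l (- y * mean_h h \<mu> x) * y) *\<^sub>R gradient (\<lambda>\<theta>'. h \<theta>' x) \<theta>"

definition L2_norm_wrt :: "'a measure \<Rightarrow> ('a \<Rightarrow> 'c::real_normed_vector) \<Rightarrow> real" where
  "L2_norm_wrt \<mu> \<xi> = sqrt (\<integral>\<theta>. (norm (\<xi> \<theta>))\<^sup>2 \<partial>\<mu>)"

end

theory Submission
  imports Defs
begin

text \<open>
  Write \<open>v(\<theta>) = \<E>\<^sub>S[s\<^sub>\<mu>(\<theta>,x,y)]\<close>, a bounded continuous
  vector field, and move \<open>\<mu>\<close> along it: \<open>\<mu>\<^sub>t = (id + t v)\<^sub>#\<mu>\<close>. Since
  test functions are \<open>C\<close>-Lipschitz, \<open>\<mu>\<^sub>t\<close> tends to \<open>\<mu>\<close> as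
  \<open>t\<close> tends to \<open>0\<close>, and \<open>\<mu>\<^sub>t\<close> is admissible because truncation
  shows that the closure of \<open>\<P>\<^sub>2\<close> is all of \<open>\<P>\<close>. Differentiating under
  the integral, the derivative of the loss along \<open>\<mu>\<^sub>t\<close> at \<open>t = 0\<close> is
  \<open>\<integral> \<parallel>v\<parallel>\<^sup>2 d\<mu>\<close>. As \<open>t\<close> may have either sign,
  local minimality forces this derivative to vanish.
\<close>

section \<open>Gradients as representing vectors\<close>

text \<open>Since \<open>gradient\<close> is a definite description, it means something only once
  existence and uniqueness are known. Existence is the Riesz representation of the derivative,
  written out in the orthonormal \<open>Basis\<close>; uniqueness holds because a vector is
  determined by its inner products.\<close>

lemma GDERIV_gradient:
  fixes f :: "'a::euclidean_space \<Rightarrow> real"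
  assumes "f differentiable (at \<theta>)"
  shows "GDERIV f \<theta> :> gradient f \<theta>"
proof -
  obtain f' where f': "(f has_derivative f') (at \<theta>)"
    using assms unfolding differentiable_def by blast
  let ?D = "\<Sum>b\<in>Basis. f' b *\<^sub>R b"
  have "f' = (\<lambda>h. inner h ?D)"
  proof
    fix h
    interpret linear f' using f' by (rule has_derivative_linear)
    have "f' h = f' (\<Sum>b\<in>Basis. inner h b *\<^sub>R b)"
      by (simp add: euclidean_representation)
    also have "\<dots> = inner h ?D"
      by (simp add: sum scale inner_sum_right mult.commute)
    finally show "f' h = inner h ?D" .
  qed
  with f' have D: "GDERIV f \<theta> :> ?D"
    unfolding gderiv_def by simp
  show ?thesis
    unfolding gradient_def
  proof (rule theI)
    show "GDERIV f \<theta> :> ?D" by (rule D)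
  next
    fix E assume "GDERIV f \<theta> :> E"
    with D have "(\<lambda>h. inner h E) = (\<lambda>h. inner h ?D)"
      unfolding gderiv_def by (metis has_derivative_unique)
    then show "E = ?D"
      by (metis vector_eq_ldot)
  qed
qed

section \<open>Push-forwards and the metric \<open>dist_F\<close>\<close>

text \<open>Both bounds are kept: the Lipschitz bound makes small displacements cheap, while the cap
  \<open>2 * C\<close> keeps the right-hand side integrable against any probability measure, even if
  \<open>norm (a - b)\<close> has no finite mean.\<close>

lemma test_function_diff_le:
  assumes "f \<in> test_functions C"
  shows "\<bar>f a - f b\<bar> \<le> min (2 * C) (C * norm (a - b))"
proof -
  have "\<bar>f a - f b\<bar> \<le> C * norm (a - b)"
    using assms lipschitz_onD[of C UNIV f a b]
    by (auto simp: test_functions_def dist_norm)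
  moreover have "\<bar>f a\<bar> \<le> C" "\<bar>f b\<bar> \<le> C"
    using assms by (auto simp: test_functions_def)
  ultimately show ?thesis by auto
qed

text \<open>Coupling \<theta> with \<open>T \<theta>\<close> under \<mu> turns the difference of the
  two integrals into one integral of \<open>f \<theta> - f (T \<theta>)\<close>. The resulting bound
  is the transport cost of this coupling and is the same for all test functions, so it passes to the
  supremum.\<close>

lemma dist_F_distr_le:
  fixes \<mu> :: "'a::euclidean_space measure"
  assumes \<mu>: "\<mu> \<in> prob_measures" and T: "T \<in> borel_measurable borel" and C: "C \<ge> 0"
  shows "dist_F C \<mu> (distr \<mu> borel T) \<le> (\<integral>\<theta>. min (2 * C) (C * norm (\<theta> - T \<theta>)) \<partial>\<mu>)"
  unfolding dist_F_def
proof (rule cSUP_least)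
  have "(\<lambda>_. 0) \<in> test_functions C"
    using C by (auto simp: test_functions_def intro!: lipschitz_onI)
  then show "test_functions C \<noteq> {}" by blast
next
  fix f :: "'a \<Rightarrow> real" assume f: "f \<in> test_functions C"
  interpret prob_space \<mu> using \<mu> by (simp add: prob_measures_def)
  have [measurable_cong]: "sets \<mu> = sets borel"
    using \<mu> by (simp add: prob_measures_def)
  note T[measurable]
  have [measurable]: "f \<in> borel_measurable borel"
    using f by (auto simp: test_functions_def
        intro!: borel_measurable_continuous_onI lipschitz_on_continuous_on)
  have bd: "\<bar>f \<theta>\<bar> \<le> C" for \<theta>
    using f by (auto simp: test_functions_def)
  have i: "integrable \<mu> f" "integrable \<mu> (\<lambda>\<theta>. f (T \<theta>))"
    by (rule integrable_const_bound[where B = C], use bd in auto)+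
  have "\<bar>(\<integral>\<theta>. f \<theta> \<partial>\<mu>) - (\<integral>\<theta>. f \<theta> \<partial>distr \<mu> borel T)\<bar>
      = \<bar>\<integral>\<theta>. f \<theta> - f (T \<theta>) \<partial>\<mu>\<bar>"
    using i by (simp add: integral_distr)
  also have "\<dots> \<le> (\<integral>\<theta>. \<bar>f \<theta> - f (T \<theta>)\<bar> \<partial>\<mu>)"
    by (rule integral_abs_bound)
  also have "\<dots> \<le> (\<integral>\<theta>. min (2 * C) (C * norm (\<theta> - T \<theta>)) \<partial>\<mu>)"
  proof (rule integral_mono)
    show "integrable \<mu> (\<lambda>\<theta>. \<bar>f \<theta> - f (T \<theta>)\<bar>)" using i by auto
    show "integrable \<mu> (\<lambda>\<theta>. min (2 * C) (C * norm (\<theta> - T \<theta>)))"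
      using C by (intro integrable_const_bound[where B = "2 * C"]) auto
  qed (rule test_function_diff_le[OF f])
  finally show "\<bar>(\<integral>\<theta>. f \<theta> \<partial>\<mu>) - (\<integral>\<theta>. f \<theta> \<partial>distr \<mu> borel T)\<bar>
      \<le> (\<integral>\<theta>. min (2 * C) (C * norm (\<theta> - T \<theta>)) \<partial>\<mu>)" .
qed

lemma distr_in_prob_measures:
  fixes \<mu> :: "'a::euclidean_space measure"
  assumes "\<mu> \<in> prob_measures" "T \<in> borel_measurable borel"
  shows "distr \<mu> borel T \<in> prob_measures"
proof -
  have "T \<in> measurable \<mu> borel"
    using assms by (simp add: prob_measures_def cong: measurable_cong_sets)
  then show ?thesis
    using assms by (simp add: prob_measures_def prob_space.prob_space_distr)
qed

text \<open>Sending everything outside a ball of radius n to the origin gives measures of bounded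
  support, hence with finite second moment. By dominated convergence the transport cost of this
  truncation vanishes as n grows, without any moment assumption on \<mu>.\<close>

lemma closure_prob_measures2_eq:
  assumes C: "C \<ge> 0"
  shows "closure_prob_measures2 C = (prob_measures :: 'a::euclidean_space measure set)"
proof (intro equalityI subsetI)
  fix \<mu> :: "'a measure" assume \<mu>: "\<mu> \<in> prob_measures"
  interpret prob_space \<mu> using \<mu> by (simp add: prob_measures_def)
  have [measurable_cong]: "sets \<mu> = sets borel"
    using \<mu> by (simp add: prob_measures_def)
  define T where "T n \<theta> = (if norm \<theta> \<le> real n then \<theta> else 0)" for n and \<theta> :: 'a
  have T[measurable]: "T n \<in> borel_measurable borel" for n
    unfolding T_def by measurable
  have P2: "distr \<mu> borel (T n) \<in> prob_measures2" for n
  proof -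
    have "norm (T n \<theta>) \<le> real n" for \<theta>
      by (auto simp: T_def)
    then have "integrable \<mu> (\<lambda>\<theta>. (norm (T n \<theta>))\<^sup>2)"
      by (intro integrable_const_bound[where B = "(real n)\<^sup>2"]) (auto intro!: power_mono)
    then have "integrable (distr \<mu> borel (T n)) (\<lambda>\<theta>. (norm \<theta>)\<^sup>2)"
      by (subst integrable_distr_eq) auto
    then show ?thesis
      using distr_in_prob_measures[OF \<mu> T] by (simp add: prob_measures2_def)
  qed
  have "(\<lambda>n. \<integral>\<theta>. min (2 * C) (C * norm (\<theta> - T n \<theta>)) \<partial>\<mu>) \<longlonglongrightarrow> (\<integral>\<theta>. 0 \<partial>\<mu>)"
  proof (rule integral_dominated_convergence[where w = "\<lambda>_. 2 * C"])
    show "AE \<theta> in \<mu>. (\<lambda>n. min (2 * C) (C * norm (\<theta> - T n \<theta>))) \<longlonglongrightarrow> 0"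
    proof (rule AE_I2)
      fix \<theta>
      \<comment> \<open>The integrand is not merely small but exactly 0 as soon as the ball contains
        \<theta>, since \<open>T n\<close> then fixes \<theta>.\<close>
      have "eventually (\<lambda>n. min (2 * C) (C * norm (\<theta> - T n \<theta>)) = 0) sequentially"
        using eventually_ge_at_top[of "nat \<lceil>norm \<theta>\<rceil>"]
      proof eventually_elim
        case (elim n)
        then have "norm \<theta> \<le> real n" by linarith
        then show ?case using C by (simp add: T_def)
      qed
      then show "(\<lambda>n. min (2 * C) (C * norm (\<theta> - T n \<theta>))) \<longlonglongrightarrow> 0"
        by (rule tendsto_eventually)
    qed
  qed (use C in auto)
  then have lim: "(\<lambda>n. \<integral>\<theta>. min (2 * C) (C * norm (\<theta> - T n \<theta>)) \<partial>\<mu>) \<longlonglongrightarrow> 0"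
    by simp
  show "\<mu> \<in> closure_prob_measures2 C"
    unfolding closure_prob_measures2_def
  proof (intro CollectI conjI allI impI \<mu>)
    fix \<epsilon> :: real assume "\<epsilon> > 0"
    with order_tendstoD(2)[OF lim] obtain n
      where "(\<integral>\<theta>. min (2 * C) (C * norm (\<theta> - T n \<theta>)) \<partial>\<mu>) < \<epsilon>"
      by (auto simp: eventually_sequentially)
    then have "dist_F C \<mu> (distr \<mu> borel (T n)) < \<epsilon>"
      using dist_F_distr_le[OF \<mu> T C, of n] by linarith
    with P2 show "\<exists>\<nu>\<in>prob_measures2. dist_F C \<mu> \<nu> < \<epsilon>" by blast
  qed
qed (simp add: closure_prob_measures2_def)

section \<open>Differentiation under the integral along a vector field\<close>

text \<open>The gradient bound makes \<open>f\<close> globally \<open>G\<close>-Lipschitz, and the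
  displacement is at most \<open>\<bar>t\<bar> * B\<close>. The difference quotients are therefore
  dominated by the constant \<open>G * B\<close>, and their pointwise limits are given by the chain
  rule.\<close>

lemma has_real_derivative_integral_along_field:
  fixes f :: "'a::euclidean_space \<Rightarrow> real" and v :: "'a \<Rightarrow> 'a"
  assumes \<mu>: "\<mu> \<in> prob_measures"
    and v: "v \<in> borel_measurable borel" and v_bd: "\<And>\<theta>. norm (v \<theta>) \<le> B"
    and f_bd: "\<And>\<theta>. \<bar>f \<theta>\<bar> \<le> A"
    and diff: "\<And>\<theta>. f differentiable (at \<theta>)"
    and g: "gradient f \<in> borel_measurable borel" and g_bd: "\<And>\<theta>. norm (gradient f \<theta>) \<le> G"
  shows "((\<lambda>t. \<integral>\<theta>. f (\<theta> + t *\<^sub>R v \<theta>) \<partial>\<mu>) has_real_derivative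
           (\<integral>\<theta>. inner (v \<theta>) (gradient f \<theta>) \<partial>\<mu>)) (at 0)"
proof -
  interpret prob_space \<mu> using \<mu> by (simp add: prob_measures_def)
  have [measurable_cong]: "sets \<mu> = sets borel"
    using \<mu> by (simp add: prob_measures_def)
  note v[measurable] g[measurable]
  have deriv: "(f has_derivative (\<lambda>h. inner h (gradient f \<theta>))) (at \<theta>)" for \<theta>
    using GDERIV_gradient[OF diff] by (simp add: gderiv_def)
  have [measurable]: "f \<in> borel_measurable borel"
    using diff by (intro borel_measurable_continuous_onI continuous_at_imp_continuous_on)
      (auto intro: differentiable_imp_continuous_within)
  have G: "0 \<le> G" using g_bd[of 0] norm_ge_zero order_trans by blast
  have lip: "\<bar>f a - f b\<bar> \<le> G * norm (a - b)" for a b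
  proof -
    have "norm (f a - f b) \<le> G * norm (a - b)"
    proof (rule differentiable_bound[of UNIV f "\<lambda>\<theta> h. inner h (gradient f \<theta>)"])
      fix \<theta>
      show "onorm (\<lambda>h. inner h (gradient f \<theta>)) \<le> G"
      proof (rule onorm_le)
        fix h
        have "norm (inner h (gradient f \<theta>)) \<le> norm h * norm (gradient f \<theta>)"
          by (simp add: Cauchy_Schwarz_ineq2)
        also have "\<dots> \<le> norm h * G" by (intro mult_left_mono g_bd) auto
        finally show "norm (inner h (gradient f \<theta>)) \<le> G * norm h"
          by (simp add: mult.commute)
      qed
    qed (use deriv in auto)
    then show ?thesis by simp
  qed
  have int: "integrable \<mu> (\<lambda>\<theta>. f (\<theta> + t *\<^sub>R v \<theta>))" for t
    using f_bd by (intro integrable_const_bound[where B = A]) auto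
  have ptw: "((\<lambda>t. f (\<theta> + t *\<^sub>R v \<theta>)) has_real_derivative inner (v \<theta>) (gradient f \<theta>)) (at 0)" for \<theta>
  proof -
    have "((\<lambda>t. f (\<theta> + t *\<^sub>R v \<theta>)) has_derivative (\<lambda>t. inner (t *\<^sub>R v \<theta>) (gradient f \<theta>))) (at 0)"
      by (rule has_derivative_compose[where g = f and f = "\<lambda>t. \<theta> + t *\<^sub>R v \<theta>"])
        (use deriv in \<open>auto intro!: derivative_eq_intros\<close>)
    then show ?thesis
      by (simp add: has_field_derivative_def mult.commute mult_commute_abs)
  qed
  \<comment> \<open>The limit is tested along arbitrary sequences of nonzero times tending to 0,
    because dominated convergence is applied to sequences.\<close>
  show ?thesis
    unfolding has_field_derivative_iff tendsto_at_iff_sequentially o_def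
  proof (intro allI impI)
    fix t :: "nat \<Rightarrow> real"
    assume t_ne: "\<forall>i. t i \<in> UNIV - {0}" and t0: "t \<longlonglongrightarrow> 0"
    have "(\<lambda>i. \<integral>\<theta>. (f (\<theta> + t i *\<^sub>R v \<theta>) - f \<theta>) / t i \<partial>\<mu>)
        \<longlonglongrightarrow> (\<integral>\<theta>. inner (v \<theta>) (gradient f \<theta>) \<partial>\<mu>)"
    proof (rule integral_dominated_convergence[where w = "\<lambda>_. G * B"])
      show "AE \<theta> in \<mu>. (\<lambda>i. (f (\<theta> + t i *\<^sub>R v \<theta>) - f \<theta>) / t i) \<longlonglongrightarrow> inner (v \<theta>) (gradient f \<theta>)"
        using ptw t_ne t0
        unfolding has_field_derivative_iff tendsto_at_iff_sequentially o_def by auto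
      show "AE \<theta> in \<mu>. norm ((f (\<theta> + t i *\<^sub>R v \<theta>) - f \<theta>) / t i) \<le> G * B" for i
      proof (rule AE_I2)
        fix \<theta>
        have "\<bar>f (\<theta> + t i *\<^sub>R v \<theta>) - f \<theta>\<bar> \<le> G * (\<bar>t i\<bar> * norm (v \<theta>))"
          using lip[of "\<theta> + t i *\<^sub>R v \<theta>" \<theta>] by simp
        also have "\<dots> \<le> G * (\<bar>t i\<bar> * B)"
          using G v_bd by (intro mult_left_mono) auto
        finally show "norm ((f (\<theta> + t i *\<^sub>R v \<theta>) - f \<theta>) / t i) \<le> G * B"
          using t_ne by (simp add: abs_divide divide_le_eq mult_ac)
      qed
    qed auto
    moreover have "(\<integral>\<theta>. (f (\<theta> + t i *\<^sub>R v \<theta>) - f \<theta>) / t i \<partial>\<mu>)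
        = ((\<integral>\<theta>. f (\<theta> + t i *\<^sub>R v \<theta>) \<partial>\<mu>) - (\<integral>\<theta>. f (\<theta> + 0 *\<^sub>R v \<theta>) \<partial>\<mu>)) / t i" for i
      using int[of "t i"] int[of 0] by simp
    ultimately show "(\<lambda>i. ((\<integral>\<theta>. f (\<theta> + t i *\<^sub>R v \<theta>) \<partial>\<mu>) - (\<integral>\<theta>. f (\<theta> + 0 *\<^sub>R v \<theta>) \<partial>\<mu>)) / (t i - 0))
        \<longlonglongrightarrow> (\<integral>\<theta>. inner (v \<theta>) (gradient f \<theta>) \<partial>\<mu>)"
      by (simp only: diff_zero)
  qed
qed

theorem theorem4:
  fixes X :: "(real ^ 'n) set"
    and h :: "real ^ 'd \<Rightarrow> real ^ 'n \<Rightarrow> real"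
    and l :: "real \<Rightarrow> real"
    and N :: nat
    and xs :: "nat \<Rightarrow> real ^ 'n"
    and ys :: "nat \<Rightarrow> real"
    and C :: real
    and \<mu> :: "(real ^ 'd) measure"
  assumes "X \<in> sets borel"
    and "\<And>\<theta> x. x \<in> X \<Longrightarrow> h \<theta> x \<in> {-1..1}"
    and "(\<lambda>(\<theta>, x). h \<theta> x) \<in> borel_measurable (restrict_space borel (UNIV \<times> X))"
    and "\<And>\<theta>. continuous_on X (h \<theta>)"
    and "N \<ge> 1"
    and "\<And>j. j \<in> {1..N} \<Longrightarrow> xs j \<in> X \<and> ys j \<in> {-1, 1}"
    and "C > 0"
    and "C2_real_function l"
    and "\<And>x. x \<in> X \<Longrightarrow> C2_function (\<lambda>\<theta>. h \<theta> x)"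
    and "bounded {gradient (\<lambda>\<theta>'. h \<theta>' x) \<theta> | \<theta> x. x \<in> X}"
    and "bounded {hessian (\<lambda>\<theta>'. h \<theta>' x) \<theta> | \<theta> x. x \<in> X}"
    and "bounded {k. \<exists>\<theta> x. x \<in> X \<and> k \<in> eigenvalues (hessian (\<lambda>\<theta>'. h \<theta>' x) \<theta>)}"
    and "local_minimum_on (dist_F C) (closure_prob_measures2 C) (emp_loss l h N xs ys) \<mu>"
  shows "L2_norm_wrt \<mu> (\<lambda>\<theta>. sample_mean N xs ys (\<lambda>x y. score l h \<mu> \<theta> x y)) = 0"
proof -

  \<comment> \<open>The perturbed measures and their distance to \<mu>\<close>
  define v where "v \<theta> = sample_mean N xs ys (\<lambda>x y. score l h \<mu> \<theta> x y)" for \<theta>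
  \<comment> \<open>\<open>c j\<close> is the derivative of
    \<open>m \<mapsto> l (- ys j * m)\<close> at \<open>m = mean_h h \<mu> (xs j)\<close>; the sign
    and the factor \<open>ys j\<close> in the score come from this inner derivative.\<close>
  define c where "c j = - deriv l (- ys j * mean_h h \<mu> (xs j)) * ys j" for j
  define grad where "grad j = gradient (\<lambda>\<theta>. h \<theta> (xs j))" for j
  have v_eq: "v \<theta> = (1 / real N) *\<^sub>R (\<Sum>j\<in>{1..N}. c j *\<^sub>R grad j \<theta>)" for \<theta>
    by (simp add: v_def sample_mean_def score_def c_def grad_def)
  \<comment> \<open>As the closure is all of \<open>prob_measures\<close>, competitors need no
    moment check.\<close>
  obtain \<epsilon> where \<epsilon>: "\<epsilon> > 0"
    and min: "\<And>\<nu>. \<nu> \<in> prob_measures \<Longrightarrow> dist_F C \<mu> \<nu> < \<epsilon> \<Longrightarrow>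
        emp_loss l h N xs ys \<mu> \<le> emp_loss l h N xs ys \<nu>"
    and \<mu>: "\<mu> \<in> prob_measures"
    using assms(13) \<open>C > 0\<close>
    by (auto simp: local_minimum_on_def closure_prob_measures2_eq)
  interpret prob_space \<mu> using \<mu> by (simp add: prob_measures_def)
  have [measurable_cong]: "sets \<mu> = sets borel"
    using \<mu> by (simp add: prob_measures_def)
  have diff: "(\<lambda>\<theta>. h \<theta> (xs j)) differentiable (at \<theta>)"
    and diff_grad: "grad j differentiable (at \<theta>)" if "j \<in> {1..N}" for j \<theta>
    using that assms(6,9) by (auto simp: C2_function_def grad_def)
  have cont_grad: "continuous_on UNIV (grad j)" if "j \<in> {1..N}" for j
    using diff_grad[OF that]
    by (intro continuous_at_imp_continuous_on) (auto intro: differentiable_imp_continuous_within)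
  have meas_grad: "grad j \<in> borel_measurable borel" if "j \<in> {1..N}" for j
    using cont_grad[OF that] by (rule borel_measurable_continuous_onI)
  have cont_h: "continuous_on UNIV (\<lambda>\<theta>. h \<theta> (xs j))" if "j \<in> {1..N}" for j
    using diff[OF that]
    by (intro continuous_at_imp_continuous_on) (auto intro: differentiable_imp_continuous_within)
  obtain G where "\<And>\<theta> x. x \<in> X \<Longrightarrow> norm (gradient (\<lambda>\<theta>'. h \<theta>' x) \<theta>) \<le> G"
    using assms(10) unfolding bounded_iff by blast
  then have grad_bd: "norm (grad j \<theta>) \<le> G" if "j \<in> {1..N}" for j \<theta>
    using that assms(6) by (auto simp: grad_def)
  have v_meas[measurable]: "v \<in> borel_measurable borel"
    unfolding v_eq using meas_grad by (intro borel_measurable_scaleR borel_measurable_sum) auto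
  define B where "B = (1 / real N) * (\<Sum>j\<in>{1..N}. \<bar>c j\<bar> * G)"
  have v_bd: "norm (v \<theta>) \<le> B" for \<theta>
  proof -
    have "norm (\<Sum>j\<in>{1..N}. c j *\<^sub>R grad j \<theta>) \<le> (\<Sum>j\<in>{1..N}. \<bar>c j\<bar> * G)"
      by (rule sum_norm_le) (auto intro!: mult_left_mono grad_bd)
    then show ?thesis
      by (simp add: v_eq B_def divide_right_mono)
  qed
  have B0: "0 \<le> B" using v_bd[of 0] norm_ge_zero order_trans by blast
  \<comment> \<open>The field \<open>v\<close> is computed from \<mu> once and stays frozen, so each
    point moves on a straight line, for t of either sign.\<close>
  define \<nu> where "\<nu> t = distr \<mu> borel (\<lambda>\<theta>. \<theta> + t *\<^sub>R v \<theta>)" for t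
  have \<nu>_prob: "\<nu> t \<in> prob_measures" for t
    unfolding \<nu>_def by (rule distr_in_prob_measures[OF \<mu>]) measurable
  have \<nu>_dist: "dist_F C \<mu> (\<nu> t) \<le> C * (\<bar>t\<bar> * B)" for t
  proof -
    have "dist_F C \<mu> (\<nu> t) \<le> (\<integral>\<theta>. min (2 * C) (C * norm (\<theta> - (\<theta> + t *\<^sub>R v \<theta>))) \<partial>\<mu>)"
      unfolding \<nu>_def using \<open>C > 0\<close> by (intro dist_F_distr_le[OF \<mu>]) auto
    also have "\<dots> \<le> (\<integral>\<theta>. C * (\<bar>t\<bar> * B) \<partial>\<mu>)"
    proof (rule integral_mono)
      show "integrable \<mu> (\<lambda>\<theta>. min (2 * C) (C * norm (\<theta> - (\<theta> + t *\<^sub>R v \<theta>))))"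
        using \<open>C > 0\<close> by (intro integrable_const_bound[where B = "2 * C"]) auto
      show "min (2 * C) (C * norm (\<theta> - (\<theta> + t *\<^sub>R v \<theta>))) \<le> C * (\<bar>t\<bar> * B)" for \<theta>
        using \<open>C > 0\<close> v_bd by (intro min.coboundedI2 mult_left_mono) (auto intro!: mult_left_mono)
    qed simp
    finally show ?thesis by (simp add: prob_space)
  qed

  \<comment> \<open>Derivative of the loss along the perturbation\<close>
  have mean_\<nu>: "mean_h h (\<nu> t) (xs j) = (\<integral>\<theta>. h (\<theta> + t *\<^sub>R v \<theta>) (xs j) \<partial>\<mu>)"
    if "j \<in> {1..N}" for t j
    unfolding mean_h_def \<nu>_def
    by (subst integral_distr) (auto intro: borel_measurable_continuous_onI[OF cont_h[OF that]])
  have mean_deriv: "((\<lambda>t. mean_h h (\<nu> t) (xs j)) has_real_derivative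
      (\<integral>\<theta>. inner (v \<theta>) (grad j \<theta>) \<partial>\<mu>)) (at 0)" if j: "j \<in> {1..N}" for j
  proof -
    have "\<bar>h \<theta> (xs j)\<bar> \<le> 1" for \<theta>
      using assms(2)[of "xs j" \<theta>] assms(6)[OF j] by auto
    then show ?thesis
      unfolding mean_\<nu>[OF j] grad_def
      by (rule has_real_derivative_integral_along_field[OF \<mu> v_meas v_bd])
        (use diff[OF j] meas_grad[OF j] grad_bd[OF j] in \<open>auto simp: grad_def\<close>)
  qed
  \<comment> \<open>The loss sees a measure only through its means at the data points, so this
    replaces an identification of \<open>\<nu> 0\<close> with \<mu>.\<close>
  have \<nu>0: "mean_h h (\<nu> 0) (xs j) = mean_h h \<mu> (xs j)" if "j \<in> {1..N}" for j
    using mean_\<nu>[OF that, of 0] by (simp add: mean_h_def)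
  define D where "D = (1 / real N) * (\<Sum>j\<in>{1..N}. c j * (\<integral>\<theta>. inner (v \<theta>) (grad j \<theta>) \<partial>\<mu>))"
  have loss_deriv: "((\<lambda>t. emp_loss l h N xs ys (\<nu> t)) has_real_derivative D) (at 0)"
    unfolding emp_loss_def D_def
  proof (intro DERIV_cmult DERIV_sum)
    fix j assume j: "j \<in> {1..N}"
    have "(l has_real_derivative deriv l u) (at u)" for u
      using assms(8) by (simp add: C2_real_function_def DERIV_deriv_iff_field_differentiable)
    from DERIV_chain2[OF this DERIV_cmult[OF mean_deriv[OF j], of "- ys j"]]
    show "((\<lambda>t. l (- ys j * mean_h h (\<nu> t) (xs j))) has_real_derivative
        c j * (\<integral>\<theta>. inner (v \<theta>) (grad j \<theta>) \<partial>\<mu>)) (at 0)"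
      by (simp add: \<nu>0[OF j] c_def mult_ac)
  qed
  have "D = (\<integral>\<theta>. inner (v \<theta>) (v \<theta>) \<partial>\<mu>)"
  proof -
    have "integrable \<mu> (\<lambda>\<theta>. inner (v \<theta>) (grad j \<theta>))" if j: "j \<in> {1..N}" for j
    proof (rule integrable_const_bound[where B = "B * G"])
      have "norm (inner (v \<theta>) (grad j \<theta>)) \<le> B * G" for \<theta>
        by (rule order_trans[OF Cauchy_Schwarz_ineq2[folded real_norm_def]])
          (intro mult_mono v_bd grad_bd[OF j] B0 norm_ge_zero)
      then show "AE \<theta> in \<mu>. norm (inner (v \<theta>) (grad j \<theta>)) \<le> B * G" by simp
      note meas_grad[OF j, measurable]
      show "(\<lambda>\<theta>. inner (v \<theta>) (grad j \<theta>)) \<in> borel_measurable \<mu>" by measurable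
    qed
    then have "D = (\<integral>\<theta>. (1 / real N) * (\<Sum>j\<in>{1..N}. c j * inner (v \<theta>) (grad j \<theta>)) \<partial>\<mu>)"
      by (simp add: D_def)
    \<comment> \<open>Here the choice of \<open>v\<close> pays off: the weighted sum of the
      gradients is \<open>v\<close> itself. The expansion \<open>v_eq\<close> is applied to the
      second argument of \<open>inner\<close> alone, leaving the first \<open>v\<close>
      intact.\<close>
    also have "\<dots> = (\<integral>\<theta>. inner (v \<theta>) (v \<theta>) \<partial>\<mu>)"
      using arg_cong[OF v_eq, of "inner (v _)"] by (simp add: inner_sum_right)
    finally show ?thesis .
  qed
  moreover have "D = 0"
  proof (rule DERIV_local_min[OF loss_deriv])
    \<comment> \<open>This radius keeps \<open>C * (\<bar>t\<bar> * B)\<close>, the bound on the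
      distance from \<mu> to \<open>\<nu> t\<close>, below \<epsilon>. Using \<open>B + 1\<close>
      avoids division by zero when \<open>B = 0\<close>.\<close>
    show "0 < \<epsilon> / (C * (B + 1))" using \<epsilon> \<open>C > 0\<close> B0 by simp
    show "\<forall>t. \<bar>0 - t\<bar> < \<epsilon> / (C * (B + 1)) \<longrightarrow>
        emp_loss l h N xs ys (\<nu> 0) \<le> emp_loss l h N xs ys (\<nu> t)"
    proof (intro allI impI)
      fix t :: real assume "\<bar>0 - t\<bar> < \<epsilon> / (C * (B + 1))"
      then have "\<bar>t\<bar> * (C * (B + 1)) < \<epsilon>"
        using \<open>C > 0\<close> B0 by (simp add: pos_less_divide_eq)
      moreover have "C * (\<bar>t\<bar> * B) \<le> \<bar>t\<bar> * (C * (B + 1))"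
        using \<open>C > 0\<close> by (simp add: algebra_simps)
      ultimately have "dist_F C \<mu> (\<nu> t) < \<epsilon>" using \<nu>_dist[of t] by linarith
      from min[OF \<nu>_prob this]
      show "emp_loss l h N xs ys (\<nu> 0) \<le> emp_loss l h N xs ys (\<nu> t)"
        using \<nu>0 by (simp add: emp_loss_def)
    qed
  qed
  \<comment> \<open>Since \<open>v\<close> is bounded and measurable, \<open>D\<close> is the true
    integral of its squared norm, not the default value 0 given to non-integrable functions.\<close>
  ultimately show ?thesis
    by (simp add: L2_norm_wrt_def power2_norm_eq_inner flip: v_def)
qed

end
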